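(* Let $\mathsf Q$ be a quasivariety and let $C$ be a clone of term operations of $\mathsf Q$. If every compact $\mathsf Q$-congruence of $\mathbf F_{\mathsf Q}(\omega)$ is u-presentable relative to $C$, then $\mathsf Q$ is $C$-structurally complete.
   Context: $\mathbf I,\mathbf S,\mathbf P_u$ denote isomorphic copies, subalgebras, ultraproducts. $\mathbf F_{\mathsf Q}(\omega)$ is the free algebra of $\mathsf Q$ on countably many generators. A $\mathsf Q$-congruence of $\mathbf A\in\mathsf Q$ is a congruence $\theta$ with $\mathbf A/\theta\in\mathsf Q$; these form an algebraic lattice $\mathrm{Con}_{\mathsf Q}(\mathbf A)$, and a compact $\mathsf Q$-congruence is a compact element of it, i.e. one generated, as a $\mathsf Q$-congruence, by finitely many pairs. The term clone of $\mathsf Q$ is the clone on $\mathbf F_{\mathsf Q}(\omega)$ generated by the fundamental operations (so its elements correspond to terms of $\mathsf Q$, and they can be interpreted in every algebra of $\mathsf Q$); a clone of term operations of $\mathsf Q$ is a subclone $C$ of it. For an algebra $\mathbf A$, $\mathbf A^C$ is the algebra with universe $A$ whose fundamental operations are those in $C$. A congruence $\theta$ of $\mathbf A$ is u-presentable relative to $C$ if there is a set $\Delta\subseteq\mathrm{Con}(\mathbf A)$ such that (i) $\theta=\bigcup\Delta$; (ii) $\Delta$ is closed under finite joins; (iii) $\mathbf A^C/\delta\in\mathbf{ISP}_u(\mathbf A^C)$ for all $\delta\in\Delta$. A $C$-quasiequation is a quasiequation containing only operations from $C$. $\mathsf Q$ is $C$-structurally complete if for every $C$-quasiequation $\Phi$,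 $\mathbf F_{\mathsf Q}(\omega)\models\Phi$ implies $\mathsf Q\models\Phi$. *)

theory Defs
  imports Main "HOL-Library.FuncSet"
begin

section \<open>Algebras, terms and quasivarieties\<close>

text \<open>
  A signature maps every operation symbol to \<open>Some\<close> of its arity; symbols sent to
  \<open>None\<close> do not belong to the signature, so that the empty signature is allowed.
  An algebra has a nonempty universe.  The value of \<open>oper A f xs\<close> is irrelevant when \<open>f\<close> is
  not in the signature, or when \<open>xs\<close> is not a tuple of elements of the universe of the right length.
\<close>

type_synonym 'f signature = "'f \<rightharpoonup> nat"

record ('f, 'a) alg =
  carrier :: "'a set"
  oper :: "'f \<Rightarrow> 'a list \<Rightarrow> 'a"

definition tuples :: "'a set \<Rightarrow> nat \<Rightarrow> 'a list set" where
  "tuples A n = {xs. set xs \<subseteq> A \<and> length xs = n}"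

definition is_algebra :: "'f signature \<Rightarrow> ('f, 'a) alg \<Rightarrow> bool" where
  "is_algebra \<Omega> A \<longleftrightarrow> carrier A \<noteq> {} \<and>
     (\<forall>f n. \<Omega> f = Some n \<longrightarrow> oper A f \<in> tuples (carrier A) n \<rightarrow> carrier A)"

datatype ('f, vars: 'v) trm = Var 'v | App 'f "('f, 'v) trm list"

primrec eval :: "('f, 'a) alg \<Rightarrow> ('v \<Rightarrow> 'a) \<Rightarrow> ('f, 'v) trm \<Rightarrow> 'a" where
  "eval A v (Var x) = v x"
| "eval A v (App f ts) = oper A f (map (eval A v) ts)"

inductive wf_trm :: "'f signature \<Rightarrow> ('f, 'v) trm \<Rightarrow> bool" for \<Omega> where
  Var: "wf_trm \<Omega> (Var x)"
| App: "\<Omega> f = Some n \<Longrightarrow> length ts = n \<Longrightarrow> (\<And>t. t \<in> set ts \<Longrightarrow> wf_trm \<Omega> t) \<Longrightarrow> wf_trm \<Omega> (App f ts)"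

text \<open>
  A quasiequation \<open>s\<^sub>1 \<approx> t\<^sub>1 \<and> \<dots> \<and> s\<^sub>k \<approx> t\<^sub>k \<longrightarrow> s \<approx> t\<close> (with \<open>k = 0\<close> allowed) is the pair of the list
  \<open>[(s\<^sub>1, t\<^sub>1), \<dots>, (s\<^sub>k, t\<^sub>k)]\<close> and \<open>(s, t)\<close>, with variables indexed by the natural numbers.
\<close>

type_synonym 'f equation = "('f, nat) trm \<times> ('f, nat) trm"
type_synonym 'f quasieq = "'f equation list \<times> 'f equation"

definition wf_quasieq :: "'f signature \<Rightarrow> 'f quasieq \<Rightarrow> bool" where
  "wf_quasieq \<Omega> \<Phi> \<longleftrightarrow>
     (\<forall>(s, t) \<in> insert (snd \<Phi>) (set (fst \<Phi>)). wf_trm \<Omega> s \<and> wf_trm \<Omega> t)"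

definition satisfies :: "('f, 'a) alg \<Rightarrow> 'f quasieq \<Rightarrow> bool" where
  "satisfies A \<Phi> \<longleftrightarrow> (\<forall>v :: nat \<Rightarrow> 'a. range v \<subseteq> carrier A \<longrightarrow>
     (\<forall>(s, t) \<in> set (fst \<Phi>). eval A v s = eval A v t) \<longrightarrow>
     eval A v (fst (snd \<Phi>)) = eval A v (snd (snd \<Phi>)))"

text \<open>
  A quasivariety is a class of algebras axiomatized by quasiequations.  As a proper class is not
  an object of HOL, it is represented by a set \<open>Ax\<close> of axioms; \<open>quasivariety \<Omega> Ax\<close>
  is polymorphic and gives the members of the class that live in a type \<open>'a\<close>.
\<close>

definition quasivariety :: "'f signature \<Rightarrow> 'f quasieq set \<Rightarrow> ('f, 'a) alg set" where
  "quasivariety \<Omega> Ax = {A. is_algebra \<Omega> A \<and> (\<forall>\<Phi>\<in>Ax. satisfies A \<Phi>)}"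


section \<open>Congruences and quotients\<close>

definition Con :: "'f signature \<Rightarrow> ('f, 'a) alg \<Rightarrow> 'a rel set" where
  "Con \<Omega> A = {\<theta>. equiv (carrier A) \<theta> \<and>
     (\<forall>f n. \<Omega> f = Some n \<longrightarrow>
       (\<forall>xs \<in> tuples (carrier A) n. \<forall>ys \<in> tuples (carrier A) n.
          list_all2 (\<lambda>x y. (x, y) \<in> \<theta>) xs ys \<longrightarrow> (oper A f xs, oper A f ys) \<in> \<theta>))}"

definition quotient_alg :: "('f, 'a) alg \<Rightarrow> 'a rel \<Rightarrow> ('f, 'a set) alg" where
  "quotient_alg A \<theta> =
     \<lparr>carrier = carrier A // \<theta>,
      oper = (\<lambda>f Xs. \<theta> `` {oper A f (map (\<lambda>X. SOME x. x \<in> X) Xs)})\<rparr>"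

definition QCon :: "'f signature \<Rightarrow> 'f quasieq set \<Rightarrow> ('f, 'a) alg \<Rightarrow> 'a rel set" where
  "QCon \<Omega> Ax A = {\<theta> \<in> Con \<Omega> A. quotient_alg A \<theta> \<in> quasivariety \<Omega> Ax}"

text \<open>
  \<open>Con \<Omega> A\<close> and, for \<open>A\<close> in the quasivariety, \<open>QCon \<Omega> Ax A\<close>
  are closed under arbitrary intersections (the empty one being the total relation), so the
  supremum of \<open>T\<close> in such a lattice \<open>L\<close> is the least member of \<open>L\<close> that includes all members of \<open>T\<close>.
\<close>

definition join_in :: "'a rel set \<Rightarrow> 'a rel set \<Rightarrow> 'a rel" where
  "join_in L T = \<Inter>{\<phi> \<in> L. \<Union>T \<subseteq> \<phi>}"

definition compact_in :: "'a rel set \<Rightarrow> 'a rel \<Rightarrow> bool" where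
  "compact_in L \<theta> \<longleftrightarrow> \<theta> \<in> L \<and>
     (\<forall>T \<subseteq> L. \<theta> \<subseteq> join_in L T \<longrightarrow> (\<exists>T0 \<subseteq> T. finite T0 \<and> \<theta> \<subseteq> join_in L T0))"


section \<open>The free algebra on countably many generators\<close>

definition term_alg :: "'f signature \<Rightarrow> ('f, ('f, nat) trm) alg" where
  "term_alg \<Omega> = \<lparr>carrier = {t. wf_trm \<Omega> t}, oper = App\<rparr>"

text \<open>
  The quotient of the term algebra by the least congruence whose quotient is in the
  quasivariety; the free generators are the classes of the variables.
\<close>

definition free_alg :: "'f signature \<Rightarrow> 'f quasieq set \<Rightarrow> ('f, ('f, nat) trm set) alg" where
  "free_alg \<Omega> Ax = quotient_alg (term_alg \<Omega>) (\<Inter>(QCon \<Omega> Ax (term_alg \<Omega>)))"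


section \<open>The class operators I, S and ultraproducts\<close>

definition is_iso :: "'f signature \<Rightarrow> ('a \<Rightarrow> 'b) \<Rightarrow> ('f, 'a) alg \<Rightarrow> ('f, 'b) alg \<Rightarrow> bool" where
  "is_iso \<Omega> h A B \<longleftrightarrow> bij_betw h (carrier A) (carrier B) \<and>
     (\<forall>f n. \<Omega> f = Some n \<longrightarrow>
       (\<forall>xs \<in> tuples (carrier A) n. h (oper A f xs) = oper B f (map h xs)))"

definition iso_copies :: "'f signature \<Rightarrow> ('f, 'a) alg set \<Rightarrow> ('f, 'b) alg set" where
  "iso_copies \<Omega> K = {B. is_algebra \<Omega> B \<and> (\<exists>A\<in>K. \<exists>h. is_iso \<Omega> h A B)}"

definition subalgebras :: "'f signature \<Rightarrow> ('f, 'a) alg set \<Rightarrow> ('f, 'a) alg set" where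
  "subalgebras \<Omega> K = {B. is_algebra \<Omega> B \<and> (\<exists>A\<in>K. carrier B \<subseteq> carrier A \<and>
     (\<forall>f n. \<Omega> f = Some n \<longrightarrow> (\<forall>xs \<in> tuples (carrier B) n. oper B f xs = oper A f xs)))}"

definition product_alg :: "'i set \<Rightarrow> ('i \<Rightarrow> ('f, 'a) alg) \<Rightarrow> ('f, 'i \<Rightarrow> 'a) alg" where
  "product_alg I A =
     \<lparr>carrier = (\<Pi>\<^sub>E i\<in>I. carrier (A i)),
      oper = (\<lambda>f xs. \<lambda>i\<in>I. oper (A i) f (map (\<lambda>x. x i) xs))\<rparr>"

definition ultrafilter_on :: "'i set \<Rightarrow> 'i set set \<Rightarrow> bool" where
  "ultrafilter_on I U \<longleftrightarrow> U \<subseteq> Pow I \<and> I \<in> U \<and> {} \<notin> U \<and>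
     (\<forall>X\<in>U. \<forall>Y\<in>U. X \<inter> Y \<in> U) \<and>
     (\<forall>X\<in>U. \<forall>Y. X \<subseteq> Y \<and> Y \<subseteq> I \<longrightarrow> Y \<in> U) \<and>
     (\<forall>X. X \<subseteq> I \<longrightarrow> X \<in> U \<or> I - X \<in> U)"

definition ultraproduct ::
    "'i set \<Rightarrow> 'i set set \<Rightarrow> ('i \<Rightarrow> ('f, 'a) alg) \<Rightarrow> ('f, ('i \<Rightarrow> 'a) set) alg" where
  "ultraproduct I U A = quotient_alg (product_alg I A)
     {(x, y). x \<in> carrier (product_alg I A) \<and> y \<in> carrier (product_alg I A) \<and>
              {i\<in>I. x i = y i} \<in> U}"

text \<open>The ultraproducts of members of \<open>K\<close> whose index set is a set of elements of type \<open>'i\<close>.\<close>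

definition ultraproducts ::
    "('f, 'a) alg set \<Rightarrow> ('f, ('i \<Rightarrow> 'a) set) alg set" where
  "ultraproducts K = {ultraproduct I U A | (I :: 'i set) U A. ultrafilter_on I U \<and> A \<in> I \<rightarrow> K}"

definition ISPu ::
    "'i itself \<Rightarrow> 'f signature \<Rightarrow> ('f, 'a) alg set \<Rightarrow> ('f, 'b) alg set" where
  "ISPu _ \<Omega> K =
     iso_copies \<Omega> (subalgebras \<Omega> (ultraproducts K :: ('f, ('i \<Rightarrow> 'a) set) alg set))"


section \<open>Clones of term operations\<close>

text \<open>
  An \<open>n\<close>-ary operation on \<open>A\<close> is a pair \<open>(n, f)\<close> where \<open>f\<close> is extensional, i.e. \<open>undefined\<close>
  outside of \<open>tuples A n\<close>.  Nullary operations are allowed in clones but not required.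
\<close>

type_synonym 'a operation = "nat \<times> ('a list \<Rightarrow> 'a)"

definition operations :: "'a set \<Rightarrow> 'a operation set" where
  "operations A = {(n, f). f \<in> tuples A n \<rightarrow>\<^sub>E A}"

definition projection :: "'a set \<Rightarrow> nat \<Rightarrow> nat \<Rightarrow> 'a operation" where
  "projection A n i = (n, \<lambda>xs \<in> tuples A n. xs ! i)"

definition composition ::
    "'a set \<Rightarrow> nat \<Rightarrow> ('a list \<Rightarrow> 'a) \<Rightarrow> ('a list \<Rightarrow> 'a) list \<Rightarrow> 'a operation" where
  "composition A n f gs = (n, \<lambda>xs \<in> tuples A n. f (map (\<lambda>g. g xs) gs))"

definition is_clone :: "'a set \<Rightarrow> 'a operation set \<Rightarrow> bool" where
  "is_clone A C \<longleftrightarrow> C \<subseteq> operations A \<and>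
     (\<forall>n i. i < n \<longrightarrow> projection A n i \<in> C) \<and>
     (\<forall>m n f gs. (m, f) \<in> C \<longrightarrow> length gs = m \<longrightarrow> (\<forall>g \<in> set gs. (n, g) \<in> C) \<longrightarrow>
        composition A n f gs \<in> C)"

definition generated_clone :: "'a set \<Rightarrow> 'a operation set \<Rightarrow> 'a operation set" where
  "generated_clone A G = \<Inter>{C. is_clone A C \<and> G \<subseteq> C}"

definition fundamental_operations :: "'f signature \<Rightarrow> ('f, 'a) alg \<Rightarrow> 'a operation set" where
  "fundamental_operations \<Omega> A =
     {(n, restrict (oper A f) (tuples (carrier A) n)) | f n. \<Omega> f = Some n}"

definition term_clone ::
    "'f signature \<Rightarrow> 'f quasieq set \<Rightarrow> ('f, nat) trm set operation set" where
  "term_clone \<Omega> Ax = generated_clone (carrier (free_alg \<Omega> Ax))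
     (fundamental_operations \<Omega> (free_alg \<Omega> Ax))"

definition is_clone_of_term_operations ::
    "'f signature \<Rightarrow> 'f quasieq set \<Rightarrow> ('f, nat) trm set operation set \<Rightarrow> bool" where
  "is_clone_of_term_operations \<Omega> Ax C \<longleftrightarrow>
     is_clone (carrier (free_alg \<Omega> Ax)) C \<and> C \<subseteq> term_clone \<Omega> Ax"

text \<open>
  A member of the term clone is interpreted in an algebra \<open>A\<close> of the quasivariety
  through a term, in the variables \<open>0, \<dots>, n - 1\<close>, that induces it on the free algebra.  Two such terms
  induce the same operation on \<open>A\<close>, so that the choice is immaterial.
\<close>

definition term_operation :: "('f, 'a) alg \<Rightarrow> nat \<Rightarrow> ('f, nat) trm \<Rightarrow> 'a operation" where
  "term_operation A n t = (n, \<lambda>xs \<in> tuples (carrier A) n. eval A (\<lambda>i. xs ! i) t)"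

definition representing_term ::
    "'f signature \<Rightarrow> 'f quasieq set \<Rightarrow> ('f, nat) trm set operation \<Rightarrow> ('f, nat) trm" where
  "representing_term \<Omega> Ax c =
     (SOME t. wf_trm \<Omega> t \<and> vars t \<subseteq> {..<fst c} \<and> term_operation (free_alg \<Omega> Ax) (fst c) t = c)"

text \<open>
  The signature of the algebras \<open>A\<^sup>C\<close> has the members of \<open>C\<close> themselves as its operation symbols.
\<close>

definition clone_signature :: "'a operation set \<Rightarrow> 'a operation signature" where
  "clone_signature C = (\<lambda>c. if c \<in> C then Some (fst c) else None)"

text \<open>
  The algebra \<open>A\<^sup>C\<close>, over the signature \<open>clone_signature C\<close>: only the interpretations of
  the members of \<open>C\<close> matter, so \<open>C\<close> need not be an argument.
\<close>

definition reduct ::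
    "'f signature \<Rightarrow> 'f quasieq set \<Rightarrow> ('f, 'a) alg \<Rightarrow> (('f, nat) trm set operation, 'a) alg" where
  "reduct \<Omega> Ax A =
     \<lparr>carrier = carrier A,
      oper = (\<lambda>c xs. eval A (\<lambda>i. xs ! i) (representing_term \<Omega> Ax c))\<rparr>"


section \<open>u-presentability and structural completeness\<close>

text \<open>
  The parameter \<open>'i\<close> bounds the index sets of the ultrapowers.  One sufficiently large
  type serves all \<open>\<delta> \<in> \<Delta>\<close> at once, because an ultrafilter can be transported along an injection of index
  sets without changing the ultrapower up to isomorphism.  A statement that assumes u-presentability
  for an arbitrary type \<open>'i\<close> thus covers ultrapowers over arbitrary index sets.

  Only nonempty finite joins are required to be in \<open>\<Delta>\<close>; as the identity relation satisfies the
  third condition, it can always be added to \<open>\<Delta>\<close>.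
\<close>

definition u_presentable ::
    "'i itself \<Rightarrow> 'f signature \<Rightarrow> 'f quasieq set \<Rightarrow> ('f, nat) trm set operation set \<Rightarrow>
     ('f, 'a) alg \<Rightarrow> 'a rel \<Rightarrow> bool" where
  "u_presentable TI \<Omega> Ax C A \<theta> \<longleftrightarrow> (\<exists>\<Delta> \<subseteq> Con \<Omega> A.
     \<theta> = \<Union>\<Delta> \<and>
     (\<forall>D \<subseteq> \<Delta>. finite D \<and> D \<noteq> {} \<longrightarrow> join_in (Con \<Omega> A) D \<in> \<Delta>) \<and>
     (\<forall>\<delta>\<in>\<Delta>. quotient_alg (reduct \<Omega> Ax A) \<delta> \<in> ISPu TI (clone_signature C) {reduct \<Omega> Ax A}))"

text \<open>
  A \<open>C\<close>-quasiequation is a quasiequation over \<open>clone_signature C\<close>; an algebra \<open>A\<close> satisfies it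
  iff \<open>A\<^sup>C\<close> does.  The type \<open>'a\<close> is the one in which the members of the quasivariety are taken.
\<close>

definition structurally_complete ::
    "'a itself \<Rightarrow> 'f signature \<Rightarrow> 'f quasieq set \<Rightarrow> ('f, nat) trm set operation set \<Rightarrow> bool" where
  "structurally_complete _ \<Omega> Ax C \<longleftrightarrow> (\<forall>\<Phi>. wf_quasieq (clone_signature C) \<Phi> \<longrightarrow>
     satisfies (reduct \<Omega> Ax (free_alg \<Omega> Ax)) \<Phi> \<longrightarrow>
     (\<forall>A \<in> (quasivariety \<Omega> Ax :: ('f, 'a) alg set). satisfies (reduct \<Omega> Ax A) \<Phi>))"

end

theory Submission
  imports Defs
begin

text \<open>
  Let \<open>F\<close> be the free algebra and let \<open>F\<^sup>C\<close> satisfy the \<open>C\<close>-quasiequation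
  \<open>s\<^sub>1 \<approx> t\<^sub>1 \<and> \<dots> \<and> s\<^sub>k \<approx> t\<^sub>k \<longrightarrow> s \<approx> t\<close>.  Suppose that a valuation \<open>v\<close> in a member \<open>A\<close> of the
  quasivariety makes the premises true.  Evaluating the terms at the free generators turns the
  premises into finitely many pairs of elements of \<open>F\<close>; let \<open>\<theta>\<close> be the relative congruence that
  they generate.  The homomorphism \<open>h\<close> from \<open>F\<close> to \<open>A\<close> that extends \<open>v\<close>
  (\<open>free_alg_extend\<close>) has a relative congruence as its kernel (\<open>hom_kernel_QCon\<close>), and this kernel
  contains the premise pairs, hence \<open>\<theta>\<close>.  So it suffices to show that the pair of the conclusion
  belongs to \<open>\<theta>\<close>.

  Being finitely generated, \<open>\<theta>\<close> is compact (\<open>finitely_generated_compact\<close>): relative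
  congruences are closed under intersections and, because a quasiequation has only finitely many
  premises, under directed unions.  So \<open>\<theta>\<close> is the union of a family \<open>\<Delta>\<close> as in the definition of
  u-presentability.  Since \<open>\<Delta>\<close> is closed under finite joins, a single \<open>\<delta> \<in> \<Delta>\<close> contains all
  premise pairs.  The quotient \<open>F\<^sup>C/\<delta>\<close> is in \<open>ISP\<^sub>u(F\<^sup>C)\<close> and therefore inherits the
  quasiequation from \<open>F\<^sup>C\<close> (\<open>satisfies_ISPu\<close>).  At the classes of the generators, its premises
  hold in \<open>F\<^sup>C/\<delta>\<close>; so does its conclusion, and the pair of the conclusion is in \<open>\<delta> \<subseteq> \<theta>\<close>.

  Satisfaction in a quotient \<open>A/\<theta>\<close> is always treated through \<open>quasieq_closed\<close>, a condition on
  the relation \<open>\<theta>\<close> that speaks of valuations in \<open>A\<close> only.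
\<close>

section \<open>Term evaluation, homomorphisms and congruences\<close>

lemma in_tuples_iff: "xs \<in> tuples A n \<longleftrightarrow> set xs \<subseteq> A \<and> length xs = n"
  by (simp add: tuples_def)

lemma oper_closed:
  assumes "is_algebra \<Omega> A" "\<Omega> f = Some n" "xs \<in> tuples (carrier A) n"
  shows "oper A f xs \<in> carrier A"
  using assms by (auto simp: is_algebra_def Pi_iff)

text \<open>
  Here and below, evaluation is studied under constraints on the variables of the term only: the valuation
  \<open>\<lambda>i. xs ! i\<close>, which defines reducts, is unspecified at \<open>i \<ge> length xs\<close>.
\<close>

lemma eval_closed:
  assumes "wf_trm \<Omega> t" "is_algebra \<Omega> A" "v ` vars t \<subseteq> carrier A"
  shows "eval A v t \<in> carrier A"
  using assms
proof (induction rule: wf_trm.induct)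
  case (App f n ts)
  then have "eval A v t \<in> carrier A" if "t \<in> set ts" for t
    using that by (force simp: image_subset_iff)
  with App show ?case
    by (auto intro!: oper_closed[of \<Omega> A f n] simp: in_tuples_iff)
qed auto

lemma eval_cong_vars: "(\<And>x. x \<in> vars t \<Longrightarrow> v x = w x) \<Longrightarrow> eval A v t = eval A w t"
proof (induction t)
  case (App f ts)
  then have "map (eval A v) ts = map (eval A w) ts"
    by (intro map_cong) auto
  then show ?case
    by (simp only: eval.simps)
qed auto

definition is_hom :: "'f signature \<Rightarrow> ('a \<Rightarrow> 'b) \<Rightarrow> ('f, 'a) alg \<Rightarrow> ('f, 'b) alg \<Rightarrow> bool" where
  "is_hom \<Omega> h A B \<longleftrightarrow> h ` carrier A \<subseteq> carrier B \<and>
     (\<forall>f n. \<Omega> f = Some n \<longrightarrow>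
       (\<forall>xs \<in> tuples (carrier A) n. h (oper A f xs) = oper B f (map h xs)))"

lemma is_hom_oper:
  assumes "is_hom \<Omega> h A B" "\<Omega> f = Some n" "xs \<in> tuples (carrier A) n"
  shows "h (oper A f xs) = oper B f (map h xs)"
  using assms by (auto simp: is_hom_def)

lemma eval_hom:
  assumes "wf_trm \<Omega> t" "is_algebra \<Omega> A" "is_hom \<Omega> h A B" "v ` vars t \<subseteq> carrier A"
  shows "h (eval A v t) = eval B (h \<circ> v) t"
  using assms
proof (induction rule: wf_trm.induct)
  case (App f n ts)
  have "map (eval A v) ts \<in> tuples (carrier A) n"
    using App by (fastforce simp: in_tuples_iff image_subset_iff intro!: eval_closed)
  then have "h (eval A v (App f ts)) = oper B f (map h (map (eval A v) ts))"
    using is_hom_oper[OF App.prems(2) App.hyps(1)] by simp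
  also have "h (eval A v t) = eval B (h \<circ> v) t" if "t \<in> set ts" for t
    using App.IH[OF that App.prems(1,2)] App.prems(3) that by (auto simp: image_subset_iff comp_def)
  then have "map h (map (eval A v) ts) = map (eval B (h \<circ> v)) ts"
    by simp
  finally show ?case
    by (simp only: eval.simps)
qed auto

lemma Con_equiv: "\<theta> \<in> Con \<Omega> A \<Longrightarrow> equiv (carrier A) \<theta>"
  by (simp add: Con_def)

lemma Con_oper:
  assumes "\<theta> \<in> Con \<Omega> A" "\<Omega> f = Some n" "list_all2 (\<lambda>x y. (x, y) \<in> \<theta>) xs ys" "length xs = n"
  shows "(oper A f xs, oper A f ys) \<in> \<theta>"
proof -
  have "\<theta> \<subseteq> carrier A \<times> carrier A"
    using Con_equiv[OF assms(1)] by (simp add: equiv_def refl_on_def)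
  with assms(3,4) have "xs \<in> tuples (carrier A) n" "ys \<in> tuples (carrier A) n"
    by (force simp: in_tuples_iff list_all2_conv_all_nth in_set_conv_nth)+
  with assms show ?thesis
    by (auto simp: Con_def)
qed

lemma eval_Con:
  assumes "wf_trm \<Omega> t" "\<theta> \<in> Con \<Omega> A" "\<And>x. x \<in> vars t \<Longrightarrow> (v x, w x) \<in> \<theta>"
  shows "(eval A v t, eval A w t) \<in> \<theta>"
  using assms
proof (induction rule: wf_trm.induct)
  case (App f n ts)
  then have "list_all2 (\<lambda>x y. (x, y) \<in> \<theta>) (map (eval A v) ts) (map (eval A w) ts)"
    by (force simp: list_all2_map1 list_all2_map2 intro!: list.rel_refl_strong)
  with App show ?case
    by (simp add: Con_oper)
qed auto

lemma hom_kernel_Con: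
  assumes "is_hom \<Omega> h A B" "is_algebra \<Omega> A"
  shows "{(x, y). x \<in> carrier A \<and> y \<in> carrier A \<and> h x = h y} \<in> Con \<Omega> A" (is "?K \<in> _")
proof -
  have "equiv (carrier A) ?K"
    by (auto intro!: equivI refl_onI symI transI)
  moreover have "(oper A f xs, oper A f ys) \<in> ?K"
    if f: "\<Omega> f = Some n" and xs: "xs \<in> tuples (carrier A) n" and ys: "ys \<in> tuples (carrier A) n"
      and rel: "list_all2 (\<lambda>x y. (x, y) \<in> ?K) xs ys" for f n xs ys
  proof -
    have "map h xs = map h ys"
      using rel by (auto simp: list_all2_conv_all_nth intro!: nth_equalityI)
    then show ?thesis
      using that assms by (simp add: is_hom_oper oper_closed)
  qed
  ultimately show ?thesis
    by (auto simp: Con_def)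
qed


section \<open>Quotients\<close>

lemma quotient_carrier: "carrier (quotient_alg A \<theta>) = carrier A // \<theta>"
  by (simp add: quotient_alg_def)

lemma some_rep_class:
  assumes "equiv S \<theta>" "X \<in> S // \<theta>"
  shows "(SOME x. x \<in> X) \<in> S" "\<theta> `` {SOME x. x \<in> X} = X"
proof -
  from assms(2) obtain y where y: "y \<in> S" "X = \<theta> `` {y}"
    by (auto elim: quotientE)
  then have "y \<in> X"
    using equiv_class_self[OF assms(1)] by blast
  then have in_X: "(SOME x. x \<in> X) \<in> X"
    by (rule someI)
  with assms show "(SOME x. x \<in> X) \<in> S"
    using in_quotient_imp_subset by blast
  from in_X y(2) have "(y, SOME x. x \<in> X) \<in> \<theta>"
    by simp
  with y(2) show "\<theta> `` {SOME x. x \<in> X} = X"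
    using equiv_class_eq[OF assms(1)] by metis
qed

lemma quotient_is_algebra:
  assumes "is_algebra \<Omega> A" "\<theta> \<in> Con \<Omega> A"
  shows "is_algebra \<Omega> (quotient_alg A \<theta>)"
proof -
  have "oper (quotient_alg A \<theta>) f Xs \<in> carrier A // \<theta>"
    if "\<Omega> f = Some n" "Xs \<in> tuples (carrier A // \<theta>) n" for f n Xs
  proof -
    have "map (\<lambda>X. SOME x. x \<in> X) Xs \<in> tuples (carrier A) n"
      using that(2) some_rep_class(1)[OF Con_equiv[OF assms(2)]] by (auto simp: in_tuples_iff)
    with that(1) assms(1) show ?thesis
      by (simp add: quotient_alg_def quotientI oper_closed)
  qed
  with assms(1) show ?thesis
    by (auto simp: is_algebra_def quotient_carrier)
qed

lemma quotient_map_hom: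
  assumes "\<theta> \<in> Con \<Omega> A"
  shows "is_hom \<Omega> (\<lambda>x. \<theta> `` {x}) A (quotient_alg A \<theta>)"
proof -
  note eq = Con_equiv[OF assms]
  have "\<theta> `` {oper A f xs} = oper (quotient_alg A \<theta>) f (map (\<lambda>x. \<theta> `` {x}) xs)"
    if f: "\<Omega> f = Some n" and xs: "xs \<in> tuples (carrier A) n" for f n xs
  proof -
    have "(x, SOME y. y \<in> \<theta> `` {x}) \<in> \<theta>" if "x \<in> set xs" for x
    proof -
      have "\<theta> `` {x} \<in> carrier A // \<theta>"
        using that xs by (auto simp: in_tuples_iff intro: quotientI)
      note rep = some_rep_class[OF eq this]
      show ?thesis
        by (rule eq_equiv_class[OF rep(2)[symmetric] eq rep(1)])
    qed
    then have "list_all2 (\<lambda>x y. (x, y) \<in> \<theta>) xs (map (\<lambda>x. SOME y. y \<in> \<theta> `` {x}) xs)"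
      by (auto simp: list_all2_map2 intro!: list.rel_refl_strong)
    then have "(oper A f xs, oper A f (map (\<lambda>x. SOME y. y \<in> \<theta> `` {x}) xs)) \<in> \<theta>"
      using Con_oper[OF assms f] xs by (auto simp: in_tuples_iff)
    then show ?thesis
      using equiv_class_eq[OF eq] by (simp add: quotient_alg_def comp_def)
  qed
  then show ?thesis
    by (auto simp: is_hom_def quotient_carrier quotientI)
qed

lemma hom_factor_quotient:
  assumes \<rho>: "\<rho> \<in> Con \<Omega> A" and h: "is_hom \<Omega> h A B" and alg: "is_algebra \<Omega> A"
    and ker: "\<And>x y. (x, y) \<in> \<rho> \<Longrightarrow> h x = h y"
  obtains g where "is_hom \<Omega> g (quotient_alg A \<rho>) B" "\<And>x. x \<in> carrier A \<Longrightarrow> g (\<rho> `` {x}) = h x"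
proof
  let ?g = "\<lambda>X. h (SOME x. x \<in> X)"
  note eq = Con_equiv[OF \<rho>]
  note rep = some_rep_class[OF eq]
  show at_class: "?g (\<rho> `` {x}) = h x" if "x \<in> carrier A" for x
    using rep[of "\<rho> `` {x}"] that ker eq_equiv_class[OF _ eq] by (metis quotientI)
  have "?g (oper (quotient_alg A \<rho>) f Xs) = oper B f (map ?g Xs)"
    if f: "\<Omega> f = Some n" and Xs: "Xs \<in> tuples (carrier A // \<rho>) n" for f n Xs
  proof -
    have "map (\<lambda>X. SOME x. x \<in> X) Xs \<in> tuples (carrier A) n"
      using Xs rep(1) by (auto simp: in_tuples_iff)
    then show ?thesis
      using at_class[OF oper_closed[OF alg f]] is_hom_oper[OF h f]
      by (simp add: quotient_alg_def comp_def)
  qed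
  then show "is_hom \<Omega> ?g (quotient_alg A \<rho>) B"
    using h rep(1) by (fastforce simp: is_hom_def quotient_carrier)
qed


section \<open>Satisfaction as a closure condition on relations\<close>

definition quasieq_closed :: "('f, 'a) alg \<Rightarrow> 'f quasieq \<Rightarrow> 'a rel \<Rightarrow> bool" where
  "quasieq_closed A \<Phi> \<theta> \<longleftrightarrow> (\<forall>v :: nat \<Rightarrow> 'a. range v \<subseteq> carrier A \<longrightarrow>
     (\<forall>(s, t) \<in> set (fst \<Phi>). (eval A v s, eval A v t) \<in> \<theta>) \<longrightarrow>
     (eval A v (fst (snd \<Phi>)), eval A v (snd (snd \<Phi>))) \<in> \<theta>)"

lemma wf_quasieqD:
  assumes "wf_quasieq \<Omega> \<Phi>"
  shows "\<And>s t. (s, t) \<in> set (fst \<Phi>) \<Longrightarrow> wf_trm \<Omega> s"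
    and "\<And>s t. (s, t) \<in> set (fst \<Phi>) \<Longrightarrow> wf_trm \<Omega> t"
    and "wf_trm \<Omega> (fst (snd \<Phi>))" "wf_trm \<Omega> (snd (snd \<Phi>))"
  using assms by (auto simp: wf_quasieq_def split: prod.splits)

text \<open>
  A homomorphism transports truth at a valuation to membership in its kernel, and surjectivity
  makes every valuation in the target the image of one in the source.
\<close>

lemma satisfies_hom_image:
  assumes hom: "is_hom \<Omega> h A B" and alg: "is_algebra \<Omega> A" and surj: "carrier B \<subseteq> h ` carrier A"
    and wf: "wf_quasieq \<Omega> \<Phi>"
  shows "satisfies B \<Phi> \<longleftrightarrow>
    quasieq_closed A \<Phi> {(x, y). x \<in> carrier A \<and> y \<in> carrier A \<and> h x = h y}"
    (is "_ \<longleftrightarrow> quasieq_closed A \<Phi> ?K")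
proof -
  note W = wf_quasieqD[OF wf]
  have ker: "(eval A v s, eval A v t) \<in> ?K \<longleftrightarrow> eval B (h \<circ> v) s = eval B (h \<circ> v) t"
    if "range v \<subseteq> carrier A" "wf_trm \<Omega> s" "wf_trm \<Omega> t" for v s t
  proof -
    have "v ` vars s \<subseteq> carrier A" "v ` vars t \<subseteq> carrier A"
      using that(1) by auto
    with that show ?thesis
      using alg hom by (simp add: eval_closed eval_hom[OF _ alg hom])
  qed
  have transfer:
    "((\<forall>(s, t) \<in> set (fst \<Phi>). (eval A v s, eval A v t) \<in> ?K) \<longrightarrow>
        (eval A v (fst (snd \<Phi>)), eval A v (snd (snd \<Phi>))) \<in> ?K) \<longleftrightarrow>
     ((\<forall>(s, t) \<in> set (fst \<Phi>). eval B (h \<circ> v) s = eval B (h \<circ> v) t) \<longrightarrow>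
        eval B (h \<circ> v) (fst (snd \<Phi>)) = eval B (h \<circ> v) (snd (snd \<Phi>)))"
    if v: "range v \<subseteq> carrier A" for v
  proof -
    have "(\<forall>(s, t) \<in> set (fst \<Phi>). (eval A v s, eval A v t) \<in> ?K) \<longleftrightarrow>
          (\<forall>(s, t) \<in> set (fst \<Phi>). eval B (h \<circ> v) s = eval B (h \<circ> v) t)"
      by (intro ball_cong refl) (use ker[OF v] W(1,2) in blast)
    with ker[OF v W(3,4)] show ?thesis
      by simp
  qed
  show ?thesis
  proof
    assume B: "satisfies B \<Phi>"
    show "quasieq_closed A \<Phi> ?K"
      unfolding quasieq_closed_def
    proof (rule allI, rule impI)
      fix v :: "nat \<Rightarrow> _"
      assume v: "range v \<subseteq> carrier A"
      then have "range (h \<circ> v) \<subseteq> carrier B"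
        using hom by (auto simp: is_hom_def)
      with B show "(\<forall>(s, t) \<in> set (fst \<Phi>). (eval A v s, eval A v t) \<in> ?K) \<longrightarrow>
          (eval A v (fst (snd \<Phi>)), eval A v (snd (snd \<Phi>))) \<in> ?K"
        unfolding satisfies_def transfer[OF v] by blast
    qed
  next
    assume K: "quasieq_closed A \<Phi> ?K"
    show "satisfies B \<Phi>"
      unfolding satisfies_def
    proof (intro allI impI)
      fix w :: "nat \<Rightarrow> _"
      assume w: "range w \<subseteq> carrier B"
        and prem: "\<forall>(s, t) \<in> set (fst \<Phi>). eval B w s = eval B w t"
      define v where "v = inv_into (carrier A) h \<circ> w"
      have "w n \<in> h ` carrier A" for n
        using w surj by blast
      then have v: "range v \<subseteq> carrier A" and hv: "h \<circ> v = w"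
        unfolding v_def by (auto simp: inv_into_into f_inv_into_f)
      show "eval B w (fst (snd \<Phi>)) = eval B w (snd (snd \<Phi>))"
        using K v transfer[OF v] prem unfolding quasieq_closed_def hv by blast
    qed
  qed
qed

lemma satisfies_quotient_iff:
  assumes "is_algebra \<Omega> A" "\<theta> \<in> Con \<Omega> A" "wf_quasieq \<Omega> \<Phi>"
  shows "satisfies (quotient_alg A \<theta>) \<Phi> \<longleftrightarrow> quasieq_closed A \<Phi> \<theta>"
proof -
  have "{(x, y). x \<in> carrier A \<and> y \<in> carrier A \<and> \<theta> `` {x} = \<theta> `` {y}} = \<theta>"
    using equiv_class_eq_iff[OF Con_equiv[OF assms(2)]] by auto
  moreover have "carrier (quotient_alg A \<theta>) \<subseteq> (\<lambda>x. \<theta> `` {x}) ` carrier A"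
    by (auto simp: quotient_carrier quotient_def)
  ultimately show ?thesis
    using satisfies_hom_image[OF quotient_map_hom[OF assms(2)] assms(1) _ assms(3)] by simp
qed

lemma QCon_iff:
  assumes "is_algebra \<Omega> A" "\<forall>\<Phi>\<in>Ax. wf_quasieq \<Omega> \<Phi>"
  shows "\<theta> \<in> QCon \<Omega> Ax A \<longleftrightarrow> \<theta> \<in> Con \<Omega> A \<and> (\<forall>\<Phi>\<in>Ax. quasieq_closed A \<Phi> \<theta>)"
  using assms satisfies_quotient_iff[OF assms(1)] quotient_is_algebra[OF assms(1)]
  by (auto simp: QCon_def quasivariety_def)

lemma satisfies_hom_kernel:
  assumes hom: "is_hom \<Omega> h A B" and alg: "is_algebra \<Omega> A" and B: "satisfies B \<Phi>"
    and wf: "wf_quasieq \<Omega> \<Phi>"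
  shows "quasieq_closed A \<Phi> {(x, y). x \<in> carrier A \<and> y \<in> carrier A \<and> h x = h y}"
proof -
  \<comment> \<open>Shrinking the carrier of the target to the image of \<open>h\<close> makes \<open>h\<close> surjective and leaves
    the evaluation of terms unchanged.\<close>
  define B' where "B' = B\<lparr>carrier := h ` carrier A\<rparr>"
  have eval: "eval B' v t = eval B v t" for v and t :: "(_, nat) trm"
    by (induction t) (auto simp: B'_def cong: map_cong)
  have "satisfies B' \<Phi>"
    unfolding satisfies_def eval
  proof (intro allI impI)
    fix v :: "nat \<Rightarrow> _"
    assume "range v \<subseteq> carrier B'"
      and prem: "\<forall>(s, t) \<in> set (fst \<Phi>). eval B v s = eval B v t"
    then have "range v \<subseteq> carrier B"
      using hom unfolding is_hom_def B'_def by auto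
    with B prem show "eval B v (fst (snd \<Phi>)) = eval B v (snd (snd \<Phi>))"
      unfolding satisfies_def by blast
  qed
  moreover have "is_hom \<Omega> h A B'" "carrier B' \<subseteq> h ` carrier A"
    using hom by (auto simp: is_hom_def B'_def)
  ultimately show ?thesis
    using satisfies_hom_image alg wf by blast
qed

lemma hom_kernel_QCon:
  assumes "is_hom \<Omega> h A B" "is_algebra \<Omega> A" "B \<in> quasivariety \<Omega> Ax" "\<forall>\<Phi>\<in>Ax. wf_quasieq \<Omega> \<Phi>"
  shows "{(x, y). x \<in> carrier A \<and> y \<in> carrier A \<and> h x = h y} \<in> QCon \<Omega> Ax A"
  using assms by (simp add: QCon_iff hom_kernel_Con satisfies_hom_kernel quasivariety_def)

lemma satisfies_embedding:
  assumes "is_hom \<Omega> h A B" "inj_on h (carrier A)" "is_algebra \<Omega> A" "wf_quasieq \<Omega> \<Phi>"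
    "satisfies B \<Phi>"
  shows "satisfies A \<Phi>"
  using satisfies_hom_kernel[OF assms(1,3,5,4)] assms(2)
  unfolding quasieq_closed_def satisfies_def
proof (intro allI impI, goal_cases)
  case (1 v)
  have "(eval A v s, eval A v t) \<in> {(x, y). x \<in> carrier A \<and> y \<in> carrier A \<and> h x = h y}"
    if "(s, t) \<in> set (fst \<Phi>)" for s t
  proof -
    have "eval A v s \<in> carrier A"
      using 1(3) by (intro eval_closed[OF wf_quasieqD(1)[OF assms(4) that] assms(3)]) auto
    moreover have "eval A v s = eval A v t"
      using 1(4) that by auto
    ultimately show ?thesis
      by simp
  qed
  with 1 have "(eval A v (fst (snd \<Phi>)), eval A v (snd (snd \<Phi>)))
      \<in> {(x, y). x \<in> carrier A \<and> y \<in> carrier A \<and> h x = h y}"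
    by blast
  with assms(2) show ?case
    by (auto dest: inj_onD)
qed


section \<open>Compactness of finitely generated relative congruences\<close>

lemma Con_total: "is_algebra \<Omega> A \<Longrightarrow> carrier A \<times> carrier A \<in> Con \<Omega> A"
  by (auto simp: Con_def oper_closed intro!: equivI refl_onI symI transI)

lemma QCon_total:
  assumes "is_algebra \<Omega> A" "\<forall>\<Phi>\<in>Ax. wf_quasieq \<Omega> \<Phi>"
  shows "carrier A \<times> carrier A \<in> QCon \<Omega> Ax A"
proof -
  have "quasieq_closed A \<Phi> (carrier A \<times> carrier A)" if "\<Phi> \<in> Ax" for \<Phi>
  proof -
    have wf: "wf_quasieq \<Omega> \<Phi>"
      using assms(2) that by blast
    have "eval A v t \<in> carrier A" if "range v \<subseteq> carrier A" "wf_trm \<Omega> t" for v and t :: "(_, nat) trm"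
      using that(1) by (intro eval_closed[OF that(2) assms(1)]) auto
    then show ?thesis
      using wf_quasieqD(3,4)[OF wf] by (simp add: quasieq_closed_def)
  qed
  with assms show ?thesis
    by (simp add: QCon_iff Con_total)
qed

lemma QCon_Inter:
  assumes "is_algebra \<Omega> A" "\<forall>\<Phi>\<in>Ax. wf_quasieq \<Omega> \<Phi>" "S \<subseteq> QCon \<Omega> Ax A" "S \<noteq> {}"
  shows "\<Inter>S \<in> QCon \<Omega> Ax A"
proof -
  have S: "\<theta> \<in> Con \<Omega> A" "\<And>\<Phi>. \<Phi> \<in> Ax \<Longrightarrow> quasieq_closed A \<Phi> \<theta>" if "\<theta> \<in> S" for \<theta>
    using that assms by (auto simp: QCon_iff)
  have "equiv (carrier A) (\<Inter>S)"
  proof (rule equivI)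
    show "\<Inter>S \<subseteq> carrier A \<times> carrier A"
      using Con_equiv[OF S(1)] assms(4) by (fastforce simp: equiv_def)
    show "refl_on (carrier A) (\<Inter>S)"
      using Con_equiv[OF S(1)] by (auto simp: equiv_def refl_on_def)
    show "sym (\<Inter>S)"
      using Con_equiv[OF S(1)] by (auto simp: equiv_def intro!: sym_INTER[of S id, simplified])
    show "trans (\<Inter>S)"
      using Con_equiv[OF S(1)] by (auto simp: equiv_def intro!: trans_INTER[of S id, simplified])
  qed
  moreover have "(oper A f xs, oper A f ys) \<in> \<Inter>S"
    if "\<Omega> f = Some n" "xs \<in> tuples (carrier A) n"
      "list_all2 (\<lambda>x y. (x, y) \<in> \<Inter>S) xs ys" for f n xs ys
  proof (rule InterI)
    fix \<theta> assume "\<theta> \<in> S"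
    with that(3) have "list_all2 (\<lambda>x y. (x, y) \<in> \<theta>) xs ys"
      by (auto elim!: list_all2_mono)
    with that show "(oper A f xs, oper A f ys) \<in> \<theta>"
      by (auto intro: Con_oper[OF S(1)[OF \<open>\<theta> \<in> S\<close>]] simp: in_tuples_iff)
  qed
  moreover have "quasieq_closed A \<Phi> (\<Inter>S)" if "\<Phi> \<in> Ax" for \<Phi>
    using S(2)[OF _ that] unfolding quasieq_closed_def by fast
  ultimately show ?thesis
    using assms by (auto simp: QCon_iff Con_def)
qed

lemma finite_subset_of_directed_Union:
  assumes "finite X" "X \<subseteq> \<Union>D" "D \<noteq> {}"
    and "\<And>\<alpha> \<beta>. \<alpha> \<in> D \<Longrightarrow> \<beta> \<in> D \<Longrightarrow> \<exists>\<gamma>\<in>D. \<alpha> \<union> \<beta> \<subseteq> \<gamma>"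
  shows "\<exists>\<delta>\<in>D. X \<subseteq> \<delta>"
  using assms(1,2)
proof induction
  case empty
  then show ?case using assms(3) by auto
next
  case (insert x X)
  then obtain \<alpha> \<beta> where "\<alpha> \<in> D" "X \<subseteq> \<alpha>" "\<beta> \<in> D" "x \<in> \<beta>"
    by auto
  with assms(4)[of \<alpha> \<beta>] show ?case
    by blast
qed

text \<open>
  Each condition for membership in \<open>QCon\<close> derives one pair from finitely many, and finitely many
  pairs of a directed union lie in a single member.
\<close>

lemma QCon_directed_Union:
  assumes "is_algebra \<Omega> A" "\<forall>\<Phi>\<in>Ax. wf_quasieq \<Omega> \<Phi>" "D \<subseteq> QCon \<Omega> Ax A" "D \<noteq> {}"
    and dir: "\<And>\<alpha> \<beta>. \<alpha> \<in> D \<Longrightarrow> \<beta> \<in> D \<Longrightarrow> \<exists>\<gamma>\<in>D. \<alpha> \<union> \<beta> \<subseteq> \<gamma>"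
  shows "\<Union>D \<in> QCon \<Omega> Ax A"
proof -
  note common = finite_subset_of_directed_Union[OF _ _ assms(4) dir]
  have D: "\<theta> \<in> Con \<Omega> A" "\<And>\<Phi>. \<Phi> \<in> Ax \<Longrightarrow> quasieq_closed A \<Phi> \<theta>" if "\<theta> \<in> D" for \<theta>
    using that assms by (auto simp: QCon_iff)
  have eq: "equiv (carrier A) \<theta>" if "\<theta> \<in> D" for \<theta>
    using that D(1) Con_equiv by blast
  have "equiv (carrier A) (\<Union>D)"
  proof (rule equivI)
    show "\<Union>D \<subseteq> carrier A \<times> carrier A"
      using eq by (fastforce simp: equiv_def)
    show "refl_on (carrier A) (\<Union>D)"
      using eq assms(4) by (fastforce simp: equiv_def refl_on_def)
    show "sym (\<Union>D)"
      using eq by (auto simp: equiv_def intro!: sym_UNION[of D id, simplified])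
    show "trans (\<Union>D)"
    proof (rule transI)
      fix x y z assume "(x, y) \<in> \<Union>D" "(y, z) \<in> \<Union>D"
      then obtain \<delta> where "\<delta> \<in> D" "{(x, y), (y, z)} \<subseteq> \<delta>"
        using common[of "{(x, y), (y, z)}"] by auto
      then show "(x, z) \<in> \<Union>D"
        using eq by (auto simp: equiv_def dest: transD)
    qed
  qed
  moreover have "(oper A f xs, oper A f ys) \<in> \<Union>D"
    if f: "\<Omega> f = Some n" and xs: "xs \<in> tuples (carrier A) n"
      and rel: "list_all2 (\<lambda>x y. (x, y) \<in> \<Union>D) xs ys" for f n xs ys
  proof -
    have "set (zip xs ys) \<subseteq> \<Union>D"
      using rel by (auto simp: list_all2_iff)
    then obtain \<delta> where "\<delta> \<in> D" "set (zip xs ys) \<subseteq> \<delta>"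
      using common[of "set (zip xs ys)"] by auto
    moreover from this(2) have "list_all2 (\<lambda>x y. (x, y) \<in> \<delta>) xs ys"
      using rel by (auto simp: list_all2_iff)
    ultimately show ?thesis
      using Con_oper[OF D(1) f, of \<delta> xs ys] xs by (auto simp: in_tuples_iff)
  qed
  moreover have "quasieq_closed A \<Phi> (\<Union>D)" if "\<Phi> \<in> Ax" for \<Phi>
    unfolding quasieq_closed_def
  proof (intro allI impI)
    fix v :: "nat \<Rightarrow> _"
    assume v: "range v \<subseteq> carrier A"
      and prem: "\<forall>(s, t) \<in> set (fst \<Phi>). (eval A v s, eval A v t) \<in> \<Union>D"
    have "\<exists>\<delta>\<in>D. (\<lambda>(s, t). (eval A v s, eval A v t)) ` set (fst \<Phi>) \<subseteq> \<delta>"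
      using prem by (intro common) auto
    then obtain \<delta> where "\<delta> \<in> D" "\<forall>(s, t) \<in> set (fst \<Phi>). (eval A v s, eval A v t) \<in> \<delta>"
      by fast
    with D(2)[OF _ that] v show "(eval A v (fst (snd \<Phi>)), eval A v (snd (snd \<Phi>))) \<in> \<Union>D"
      unfolding quasieq_closed_def by blast
  qed
  ultimately show ?thesis
    using assms by (auto simp: QCon_iff Con_def)
qed

text \<open>
  The joins of the finite subfamilies of \<open>T\<close> form a directed family, whose union is again in \<open>L\<close>
  and hence is the join of \<open>T\<close>; so finitely many pairs below the join of \<open>T\<close> are below one of them.
\<close>

lemma finitely_generated_compact:
  assumes top: "M \<in> L" "\<And>\<phi>. \<phi> \<in> L \<Longrightarrow> \<phi> \<subseteq> M"
    and inter: "\<And>S. S \<subseteq> L \<Longrightarrow> S \<noteq> {} \<Longrightarrow> \<Inter>S \<in> L"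
    and directed: "\<And>D. D \<subseteq> L \<Longrightarrow> D \<noteq> {} \<Longrightarrow>
      (\<And>\<alpha> \<beta>. \<alpha> \<in> D \<Longrightarrow> \<beta> \<in> D \<Longrightarrow> \<exists>\<gamma>\<in>D. \<alpha> \<union> \<beta> \<subseteq> \<gamma>) \<Longrightarrow> \<Union>D \<in> L"
    and X: "finite X" "X \<subseteq> M"
  shows "compact_in L (\<Inter>{\<phi> \<in> L. X \<subseteq> \<phi>})"
  unfolding compact_in_def
proof (intro conjI allI impI)
  show "\<Inter>{\<phi> \<in> L. X \<subseteq> \<phi>} \<in> L"
    using top X by (intro inter) auto
next
  fix T assume T: "T \<subseteq> L" and below: "\<Inter>{\<phi> \<in> L. X \<subseteq> \<phi>} \<subseteq> join_in L T"
  have join: "join_in L S \<in> L" if "S \<subseteq> L" for S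
    unfolding join_in_def using top that by (intro inter) auto
  have mono: "join_in L S \<subseteq> join_in L S'" if "S \<subseteq> S'" for S S'
    unfolding join_in_def using that by blast
  define D where "D = join_in L ` {T0. T0 \<subseteq> T \<and> finite T0}"
  have DL: "D \<subseteq> L"
    using join T by (auto simp: D_def)
  have ne: "D \<noteq> {}"
    by (auto simp: D_def)
  have dir: "\<exists>\<gamma>\<in>D. \<alpha> \<union> \<beta> \<subseteq> \<gamma>" if \<alpha>\<beta>: "\<alpha> \<in> D" "\<beta> \<in> D" for \<alpha> \<beta>
  proof -
    obtain P Q where "P \<subseteq> T" "finite P" "\<alpha> = join_in L P" "Q \<subseteq> T" "finite Q" "\<beta> = join_in L Q"
      using \<alpha>\<beta> by (auto simp: D_def)
    then show ?thesis
      using mono[of P "P \<union> Q"] mono[of Q "P \<union> Q"]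
      by (intro bexI[of _ "join_in L (P \<union> Q)"]) (auto simp: D_def)
  qed
  have "\<tau> \<subseteq> \<Union>D" if "\<tau> \<in> T" for \<tau>
  proof -
    have "join_in L {\<tau>} \<in> D"
      using that by (auto simp: D_def)
    moreover have "\<tau> \<subseteq> join_in L {\<tau>}"
      by (auto simp: join_in_def)
    ultimately show ?thesis
      by blast
  qed
  then have "join_in L T \<subseteq> \<Union>D"
    using directed[OF DL ne dir] unfolding join_in_def by blast
  with below have "X \<subseteq> \<Union>D"
    by blast
  then obtain \<delta> where "\<delta> \<in> D" "X \<subseteq> \<delta>"
    using finite_subset_of_directed_Union[OF X(1) _ ne dir] by blast
  with DL show "\<exists>T0\<subseteq>T. finite T0 \<and> \<Inter>{\<phi> \<in> L. X \<subseteq> \<phi>} \<subseteq> join_in L T0"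
    by (auto simp: D_def)
qed

corollary compact_QCon_generated:
  assumes "is_algebra \<Omega> A" "\<forall>\<Phi>\<in>Ax. wf_quasieq \<Omega> \<Phi>" "finite X" "X \<subseteq> carrier A \<times> carrier A"
  shows "compact_in (QCon \<Omega> Ax A) (\<Inter>{\<phi> \<in> QCon \<Omega> Ax A. X \<subseteq> \<phi>})"
proof (rule finitely_generated_compact[OF QCon_total[OF assms(1,2)] _ _ _ assms(3,4)])
  show "\<phi> \<subseteq> carrier A \<times> carrier A" if "\<phi> \<in> QCon \<Omega> Ax A" for \<phi>
    using that by (auto simp: QCon_def Con_def equiv_def)
qed (use QCon_Inter[OF assms(1,2)] QCon_directed_Union[OF assms(1,2)] in blast)+


section \<open>Preservation of quasiequations by \<open>ISP\<^sub>u\<close>\<close>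

lemma product_is_algebra:
  assumes "\<And>i. i \<in> I \<Longrightarrow> is_algebra \<Omega> (A i)"
  shows "is_algebra \<Omega> (product_alg I A)"
proof -
  have "carrier (product_alg I A) \<noteq> {}"
    using assms by (auto simp: product_alg_def PiE_eq_empty_iff is_algebra_def)
  moreover have "oper (product_alg I A) f xs \<in> carrier (product_alg I A)"
    if "\<Omega> f = Some n" "xs \<in> tuples (carrier (product_alg I A)) n" for f n xs
    using that
    by (fastforce simp: product_alg_def in_tuples_iff intro!: oper_closed[OF assms that(1)])
  ultimately show ?thesis
    by (auto simp: is_algebra_def)
qed

lemma product_projection_hom:
  assumes "i \<in> I"
  shows "is_hom \<Omega> (\<lambda>x. x i) (product_alg I A) (A i)"
  using assms by (auto simp: is_hom_def product_alg_def)

text \<open>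
  This is the theorem of Los for quasiequations: the set of indices at which the conclusion holds
  includes the intersection of the finitely many sets at which the premises hold.
\<close>

lemma satisfies_ultraproduct:
  assumes alg: "\<And>i. i \<in> I \<Longrightarrow> is_algebra \<Omega> (A i)" and U: "ultrafilter_on I U"
    and wf: "wf_quasieq \<Omega> \<Phi>" and sat: "\<And>i. i \<in> I \<Longrightarrow> satisfies (A i) \<Phi>"
  shows "satisfies (ultraproduct I U A) \<Phi>"
proof -
  let ?P = "product_alg I A"
  define \<theta> where "\<theta> = {(x, y). x \<in> carrier ?P \<and> y \<in> carrier ?P \<and> {i\<in>I. x i = y i} \<in> U}"
  have top: "I \<in> U" and Int: "\<And>X Y. X \<in> U \<Longrightarrow> Y \<in> U \<Longrightarrow> X \<inter> Y \<in> U"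
    and up: "\<And>X Y. X \<in> U \<Longrightarrow> X \<subseteq> Y \<Longrightarrow> Y \<subseteq> I \<Longrightarrow> Y \<in> U"
    using U by (auto simp: ultrafilter_on_def)
  have all: "{i\<in>I. \<forall>z\<in>Z. R z i} \<in> U" if "finite Z" "\<And>z. z \<in> Z \<Longrightarrow> {i\<in>I. R z i} \<in> U"
    for Z and R :: "'z \<Rightarrow> _ \<Rightarrow> bool"
    using that
  proof (induction)
    case (insert z Z)
    then have "{i\<in>I. R z i} \<inter> {i\<in>I. \<forall>z\<in>Z. R z i} \<in> U"
      by (intro Int) auto
    then show ?case
      by (rule up) auto
  qed (use top in simp)
  have algP: "is_algebra \<Omega> ?P"
    by (rule product_is_algebra[OF alg])
  have "\<theta> \<in> Con \<Omega> ?P"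
  proof -
    have "trans \<theta>"
    proof (rule transI)
      fix x y z assume xy: "(x, y) \<in> \<theta>" and yz: "(y, z) \<in> \<theta>"
      then have "{i\<in>I. x i = y i} \<inter> {i\<in>I. y i = z i} \<in> U"
        by (intro Int) (auto simp: \<theta>_def)
      then have "{i\<in>I. x i = z i} \<in> U"
        by (rule up) auto
      with xy yz show "(x, z) \<in> \<theta>"
        by (simp add: \<theta>_def)
    qed
    moreover have "sym \<theta>"
      by (auto simp: \<theta>_def sym_def eq_commute)
    ultimately have "equiv (carrier ?P) \<theta>"
      using top by (intro equivI refl_onI) (auto simp: \<theta>_def)
    moreover have "(oper ?P f xs, oper ?P f ys) \<in> \<theta>"
      if f: "\<Omega> f = Some n" and xs: "xs \<in> tuples (carrier ?P) n" and ys: "ys \<in> tuples (carrier ?P) n"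
        and rel: "list_all2 (\<lambda>x y. (x, y) \<in> \<theta>) xs ys" for f n xs ys
    proof -
      have "{i\<in>I. \<forall>z\<in>set (zip xs ys). fst z i = snd z i} \<in> U"
        using rel by (intro all) (auto simp: list_all2_iff \<theta>_def)
      moreover have "oper ?P f xs i = oper ?P f ys i"
        if "i \<in> I" "\<forall>z\<in>set (zip xs ys). fst z i = snd z i" for i
      proof -
        have "map (\<lambda>x. x i) xs = map (\<lambda>x. x i) ys"
          using that(2) list_all2_lengthD[OF rel] by (induction xs ys rule: list_induct2') auto
        then show ?thesis
          using that(1) by (simp add: product_alg_def)
      qed
      ultimately have "{i\<in>I. oper ?P f xs i = oper ?P f ys i} \<in> U"
        by (elim up) auto
      then show ?thesis
        using oper_closed[OF algP f] xs ys by (simp add: \<theta>_def)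
    qed
    ultimately show ?thesis
      by (auto simp: Con_def)
  qed
  moreover have "quasieq_closed ?P \<Phi> \<theta>"
    unfolding quasieq_closed_def
  proof (intro allI impI)
    fix v :: "nat \<Rightarrow> _"
    assume v: "range v \<subseteq> carrier ?P"
      and prem: "\<forall>(s, t) \<in> set (fst \<Phi>). (eval ?P v s, eval ?P v t) \<in> \<theta>"
    note W = wf_quasieqD[OF wf]
    have vars: "v ` vars t \<subseteq> carrier ?P" for t :: "(_, nat) trm"
      using v by auto
    have comp: "eval ?P v t i = eval (A i) (\<lambda>x. v x i) t" if "i \<in> I" "wf_trm \<Omega> t" for i t
      using eval_hom[OF that(2) algP product_projection_hom[OF that(1)] vars] by (simp add: comp_def)
    have "{i\<in>I. \<forall>(s, t)\<in>set (fst \<Phi>). eval ?P v s i = eval ?P v t i} \<in> U"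
      using prem by (intro all) (auto simp: \<theta>_def)
    moreover have "eval ?P v (fst (snd \<Phi>)) i = eval ?P v (snd (snd \<Phi>)) i"
      if i: "i \<in> I" and eqs: "\<forall>(s, t)\<in>set (fst \<Phi>). eval ?P v s i = eval ?P v t i" for i
    proof -
      have "range (\<lambda>x. v x i) \<subseteq> carrier (A i)"
        using v i by (fastforce simp: product_alg_def)
      moreover have "\<forall>(s, t)\<in>set (fst \<Phi>). eval (A i) (\<lambda>x. v x i) s = eval (A i) (\<lambda>x. v x i) t"
        using eqs W(1,2) by (fastforce simp: comp[OF i])
      ultimately show ?thesis
        using sat[OF i] by (simp add: satisfies_def comp[OF i W(3)] comp[OF i W(4)])
    qed
    ultimately have "{i\<in>I. eval ?P v (fst (snd \<Phi>)) i = eval ?P v (snd (snd \<Phi>)) i} \<in> U"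
      by (elim up) auto
    then show "(eval ?P v (fst (snd \<Phi>)), eval ?P v (snd (snd \<Phi>))) \<in> \<theta>"
      using eval_closed[OF W(3) algP vars] eval_closed[OF W(4) algP vars] by (simp add: \<theta>_def)
  qed
  ultimately show ?thesis
    using satisfies_quotient_iff[OF algP _ wf] by (simp add: ultraproduct_def \<theta>_def)
qed

lemma satisfies_ISPu:
  fixes K :: "('f, 'a) alg set" and B :: "('f, 'b) alg"
  assumes B: "B \<in> ISPu TYPE('i) \<Omega> K" and alg: "\<And>A. A \<in> K \<Longrightarrow> is_algebra \<Omega> A"
    and wf: "wf_quasieq \<Omega> \<Phi>" and sat: "\<And>A. A \<in> K \<Longrightarrow> satisfies A \<Phi>"
  shows "satisfies B \<Phi>"
proof -
  obtain h S and I :: "'i set" and U A where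
    iso: "is_iso \<Omega> h S B" and algB: "is_algebra \<Omega> B" and algS: "is_algebra \<Omega> S"
    and sub: "carrier S \<subseteq> carrier (ultraproduct I U A)"
      "\<forall>f n. \<Omega> f = Some n \<longrightarrow>
        (\<forall>xs \<in> tuples (carrier S) n. oper S f xs = oper (ultraproduct I U A) f xs)"
    and U: "ultrafilter_on I U" and A: "A \<in> I \<rightarrow> K"
    using B unfolding ISPu_def iso_copies_def subalgebras_def ultraproducts_def by blast
  have "is_hom \<Omega> (\<lambda>x. x) S (ultraproduct I U A)"
    using sub by (auto simp: is_hom_def)
  moreover have "satisfies (ultraproduct I U A) \<Phi>"
    using A alg sat by (intro satisfies_ultraproduct[OF _ U wf]) auto
  ultimately have satS: "satisfies S \<Phi>"
    using satisfies_embedding[OF _ inj_on_id2 algS wf] by blast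
  have bij: "bij_betw h (carrier S) (carrier B)"
    using iso by (simp add: is_iso_def)
  define g where "g = inv_into (carrier S) h"
  have g: "bij_betw g (carrier B) (carrier S)"
    unfolding g_def by (rule bij_betw_inv_into[OF bij])
  have "g (oper B f ys) = oper S f (map g ys)"
    if f: "\<Omega> f = Some n" and ys: "ys \<in> tuples (carrier B) n" for f n ys
  proof -
    have xs: "map g ys \<in> tuples (carrier S) n"
      using ys g by (auto simp: in_tuples_iff bij_betw_def)
    have "map h (map g ys) = ys"
      using ys bij by (auto simp: g_def in_tuples_iff bij_betw_def f_inv_into_f intro!: map_idI)
    then have "oper B f ys = h (oper S f (map g ys))"
      using iso f xs by (auto simp: is_iso_def)
    then show ?thesis
      using oper_closed[OF algS f xs] bij by (simp add: g_def bij_betw_def)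
  qed
  then have "is_hom \<Omega> g B S"
    using g by (auto simp: is_hom_def bij_betw_def)
  then show ?thesis
    using satisfies_embedding[OF _ _ algB wf satS] g by (auto simp: bij_betw_def)
qed


section \<open>The free algebra\<close>

lemma term_alg_is_algebra: "is_algebra \<Omega> (term_alg \<Omega>)"
proof -
  have "wf_trm \<Omega> (Var 0)"
    by (rule wf_trm.Var)
  then show ?thesis
    by (auto simp: is_algebra_def term_alg_def in_tuples_iff intro!: wf_trm.App)
qed

lemma eval_hom_term_alg:
  assumes "is_algebra \<Omega> A" "range v \<subseteq> carrier A"
  shows "is_hom \<Omega> (eval A v) (term_alg \<Omega>) A"
  using assms by (auto simp: is_hom_def term_alg_def intro!: eval_closed)

definition free_cong :: "'f signature \<Rightarrow> 'f quasieq set \<Rightarrow> ('f, nat) trm rel" where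
  "free_cong \<Omega> Ax = \<Inter>(QCon \<Omega> Ax (term_alg \<Omega>))"

lemma free_cong_Con:
  assumes "\<forall>\<Phi>\<in>Ax. wf_quasieq \<Omega> \<Phi>"
  shows "free_cong \<Omega> Ax \<in> Con \<Omega> (term_alg \<Omega>)"
proof -
  have "free_cong \<Omega> Ax \<in> QCon \<Omega> Ax (term_alg \<Omega>)"
    unfolding free_cong_def
    using QCon_total[OF term_alg_is_algebra assms] by (intro QCon_Inter[OF term_alg_is_algebra assms]) auto
  then show ?thesis
    by (simp add: QCon_def)
qed

lemma free_alg_is_algebra:
  assumes "\<forall>\<Phi>\<in>Ax. wf_quasieq \<Omega> \<Phi>"
  shows "is_algebra \<Omega> (free_alg \<Omega> Ax)"
  using quotient_is_algebra[OF term_alg_is_algebra free_cong_Con[OF assms]]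
  by (simp add: free_alg_def free_cong_def)

definition generator :: "'f signature \<Rightarrow> 'f quasieq set \<Rightarrow> nat \<Rightarrow> ('f, nat) trm set" where
  "generator \<Omega> Ax i = free_cong \<Omega> Ax `` {Var i}"

lemma generator_in_carrier: "generator \<Omega> Ax i \<in> carrier (free_alg \<Omega> Ax)"
  by (simp add: free_alg_def quotient_carrier generator_def free_cong_def term_alg_def
      quotientI wf_trm.Var)

text \<open>
  This is the universal property of the free algebra.  Evaluation at \<open>v\<close> factors through the
  quotient because its kernel is one of the relative congruences of which \<open>free_cong\<close> is the
  intersection.
\<close>

lemma free_alg_extend:
  assumes wf: "\<forall>\<Phi>\<in>Ax. wf_quasieq \<Omega> \<Phi>" and A: "A \<in> quasivariety \<Omega> Ax" and v: "range v \<subseteq> carrier A"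
  obtains h where "is_hom \<Omega> h (free_alg \<Omega> Ax) A" "h \<circ> generator \<Omega> Ax = v"
proof -
  have "is_algebra \<Omega> A"
    using A by (simp add: quasivariety_def)
  note hom = eval_hom_term_alg[OF this v]
  have "eval A v s = eval A v t" if "(s, t) \<in> free_cong \<Omega> Ax" for s t
    using that hom_kernel_QCon[OF hom term_alg_is_algebra A wf] by (auto simp: free_cong_def)
  then obtain h where h: "is_hom \<Omega> h (quotient_alg (term_alg \<Omega>) (free_cong \<Omega> Ax)) A"
      "\<And>t. t \<in> carrier (term_alg \<Omega>) \<Longrightarrow> h (free_cong \<Omega> Ax `` {t}) = eval A v t"
    using hom_factor_quotient[OF free_cong_Con[OF wf] hom term_alg_is_algebra] by blast
  show ?thesis
  proof
    show "is_hom \<Omega> h (free_alg \<Omega> Ax) A"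
      using h(1) by (simp add: free_alg_def free_cong_def)
    show "h \<circ> generator \<Omega> Ax = v"
      using h(2)[of "Var _"] by (auto simp: generator_def term_alg_def wf_trm.Var)
  qed
qed


section \<open>Representing terms and reducts\<close>

primrec subst :: "('v \<Rightarrow> ('f, 'w) trm) \<Rightarrow> ('f, 'v) trm \<Rightarrow> ('f, 'w) trm" where
  "subst \<sigma> (Var x) = \<sigma> x"
| "subst \<sigma> (App f ts) = App f (map (subst \<sigma>) ts)"

lemma eval_subst: "eval A v (subst \<sigma> t) = eval A (\<lambda>x. eval A v (\<sigma> x)) t"
  by (induction t) (auto cong: map_cong intro!: arg_cong[where f = "oper A _"])

lemma vars_subst: "vars (subst \<sigma> t) = (\<Union>x\<in>vars t. vars (\<sigma> x))"
  by (induction t) auto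

lemma wf_subst: "wf_trm \<Omega> t \<Longrightarrow> (\<And>x. x \<in> vars t \<Longrightarrow> wf_trm \<Omega> (\<sigma> x)) \<Longrightarrow> wf_trm \<Omega> (subst \<sigma> t)"
  by (induction rule: wf_trm.induct) (fastforce intro!: wf_trm.App)+

definition term_operations :: "'f signature \<Rightarrow> ('f, 'a) alg \<Rightarrow> 'a operation set" where
  "term_operations \<Omega> A = {term_operation A n t | n t. wf_trm \<Omega> t \<and> vars t \<subseteq> {..<n}}"

text \<open>
  The term clone is the least clone that contains the fundamental operations, and the term operations
  form such a clone.  So every member of the term clone is induced by a term, and the choice in
  \<open>representing_term\<close> has a witness.
\<close>

lemma term_operations_clone:
  assumes alg: "is_algebra \<Omega> A"
  shows "is_clone (carrier A) (term_operations \<Omega> A)"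
  unfolding is_clone_def
proof (intro conjI allI impI)
  show "term_operations \<Omega> A \<subseteq> operations (carrier A)"
  proof
    fix c assume "c \<in> term_operations \<Omega> A"
    then obtain n t where t: "wf_trm \<Omega> t" "vars t \<subseteq> {..<n}" "c = term_operation A n t"
      by (auto simp: term_operations_def)
    have "eval A ((!) xs) t \<in> carrier A" if "xs \<in> tuples (carrier A) n" for xs
      using that t(2) by (intro eval_closed[OF t(1) alg]) (fastforce simp: in_tuples_iff)
    then show "c \<in> operations (carrier A)"
      by (auto simp: t(3) operations_def term_operation_def)
  qed
next
  fix n i :: nat assume "i < n"
  then show "projection (carrier A) n i \<in> term_operations \<Omega> A"
    by (auto simp: term_operations_def projection_def term_operation_def wf_trm.Var
        intro!: exI[of _ "Var i"])
next
  fix m n f gs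
  assume f: "(m, f) \<in> term_operations \<Omega> A" and len: "length gs = m"
    and gs: "\<forall>g\<in>set gs. (n, g) \<in> term_operations \<Omega> A"
  obtain t where t: "wf_trm \<Omega> t" "vars t \<subseteq> {..<m}"
      "f = (\<lambda>xs \<in> tuples (carrier A) m. eval A (\<lambda>i. xs ! i) t)"
    using f by (auto simp: term_operations_def term_operation_def)
  have "\<forall>g\<in>set gs. \<exists>u. wf_trm \<Omega> u \<and> vars u \<subseteq> {..<n} \<and>
      g = (\<lambda>xs \<in> tuples (carrier A) n. eval A (\<lambda>i. xs ! i) u)"
    using gs by (auto simp: term_operations_def term_operation_def)
  then obtain u where u: "\<And>g. g \<in> set gs \<Longrightarrow> wf_trm \<Omega> (u g)"
      "\<And>g. g \<in> set gs \<Longrightarrow> vars (u g) \<subseteq> {..<n}"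
      "\<And>g. g \<in> set gs \<Longrightarrow> g = (\<lambda>xs \<in> tuples (carrier A) n. eval A (\<lambda>i. xs ! i) (u g))"
    by metis
  define r where "r = subst (\<lambda>i. u (gs ! i)) t"
  have "wf_trm \<Omega> r"
    unfolding r_def using t(2) len u(1) by (intro wf_subst[OF t(1)]) auto
  moreover have "vars r \<subseteq> {..<n}"
    unfolding r_def vars_subst using t(2) len u(2) by (force simp: subset_iff)
  moreover have "f (map (\<lambda>g. g xs) gs) = eval A (\<lambda>i. xs ! i) r" if xs: "xs \<in> tuples (carrier A) n" for xs
  proof -
    have val: "g xs = eval A (\<lambda>i. xs ! i) (u g)" if "g \<in> set gs" for g
      using u(3)[OF that] xs by (metis restrict_apply')
    have "g xs \<in> carrier A" if "g \<in> set gs" for g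
      unfolding val[OF that] using xs u(2)[OF that]
      by (intro eval_closed[OF u(1)[OF that] alg]) (fastforce simp: in_tuples_iff)
    then have "map (\<lambda>g. g xs) gs \<in> tuples (carrier A) m"
      using len by (auto simp: in_tuples_iff)
    then have "f (map (\<lambda>g. g xs) gs) = eval A (\<lambda>i. map (\<lambda>g. g xs) gs ! i) t"
      by (simp add: t(3))
    also have "\<dots> = eval A (\<lambda>i. eval A (\<lambda>j. xs ! j) (u (gs ! i))) t"
      using t(2) len val by (intro eval_cong_vars) auto
    finally show ?thesis
      by (simp add: r_def eval_subst)
  qed
  ultimately show "composition (carrier A) n f gs \<in> term_operations \<Omega> A"
    unfolding term_operations_def composition_def term_operation_def
    by (auto intro!: exI[of _ r] restrict_ext)
qed

lemma fundamental_operations_subset: "fundamental_operations \<Omega> A \<subseteq> term_operations \<Omega> A"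
proof
  fix c assume "c \<in> fundamental_operations \<Omega> A"
  then obtain f n where f: "\<Omega> f = Some n" "c = (n, restrict (oper A f) (tuples (carrier A) n))"
    by (auto simp: fundamental_operations_def)
  define t where "t = App f (map Var [0..<n])"
  have "wf_trm \<Omega> t"
    using f(1) by (auto simp: t_def intro!: wf_trm.App wf_trm.Var)
  moreover have "vars t \<subseteq> {..<n}"
    by (auto simp: t_def)
  moreover have "c = term_operation A n t"
    by (auto simp: f(2) t_def term_operation_def in_tuples_iff comp_def map_nth intro!: restrict_ext)
  ultimately show "c \<in> term_operations \<Omega> A"
    by (auto simp: term_operations_def)
qed

lemma representing_term:
  assumes wf: "\<forall>\<Phi>\<in>Ax. wf_quasieq \<Omega> \<Phi>" and C: "is_clone_of_term_operations \<Omega> Ax C" and c: "c \<in> C"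
  shows "wf_trm \<Omega> (representing_term \<Omega> Ax c)" "vars (representing_term \<Omega> Ax c) \<subseteq> {..<fst c}"
proof -
  have "c \<in> term_operations \<Omega> (free_alg \<Omega> Ax)"
    using C c term_operations_clone[OF free_alg_is_algebra[OF wf]]
      fundamental_operations_subset[of \<Omega> "free_alg \<Omega> Ax"]
    unfolding is_clone_of_term_operations_def term_clone_def generated_clone_def by blast
  then have "\<exists>t. wf_trm \<Omega> t \<and> vars t \<subseteq> {..<fst c} \<and> term_operation (free_alg \<Omega> Ax) (fst c) t = c"
    by (auto simp: term_operations_def term_operation_def)
  from someI_ex[OF this] show "wf_trm \<Omega> (representing_term \<Omega> Ax c)"
      "vars (representing_term \<Omega> Ax c) \<subseteq> {..<fst c}"
    unfolding representing_term_def by blast+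
qed

lemma clone_signature_Some: "clone_signature C c = Some n \<longleftrightarrow> c \<in> C \<and> n = fst c"
  by (auto simp: clone_signature_def)

lemma carrier_reduct [simp]: "carrier (reduct \<Omega> Ax A) = carrier A"
  by (simp add: reduct_def)

context
  fixes \<Omega> :: "'f signature" and Ax :: "'f quasieq set" and C :: "('f, nat) trm set operation set"
  assumes wf: "\<forall>\<Phi>\<in>Ax. wf_quasieq \<Omega> \<Phi>" and C: "is_clone_of_term_operations \<Omega> Ax C"
begin

lemma reduct_is_algebra:
  assumes "is_algebra \<Omega> A"
  shows "is_algebra (clone_signature C) (reduct \<Omega> Ax A)"
proof -
  have "oper (reduct \<Omega> Ax A) c xs \<in> carrier A" if "c \<in> C" "xs \<in> tuples (carrier A) (fst c)" for c xs
  proof -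
    have "(!) xs ` vars (representing_term \<Omega> Ax c) \<subseteq> carrier A"
      using representing_term(2)[OF wf C that(1)] that(2) by (fastforce simp: in_tuples_iff)
    then show ?thesis
      using eval_closed[OF representing_term(1)[OF wf C that(1)] assms] by (simp add: reduct_def)
  qed
  with assms show ?thesis
    by (auto simp: is_algebra_def clone_signature_Some)
qed

lemma reduct_hom:
  assumes alg: "is_algebra \<Omega> A" and h: "is_hom \<Omega> h A B"
  shows "is_hom (clone_signature C) h (reduct \<Omega> Ax A) (reduct \<Omega> Ax B)"
proof -
  have "h (oper (reduct \<Omega> Ax A) c xs) = oper (reduct \<Omega> Ax B) c (map h xs)"
    if c: "c \<in> C" and xs: "xs \<in> tuples (carrier A) (fst c)" for c xs
  proof -
    let ?t = "representing_term \<Omega> Ax c"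
    note t = representing_term[OF wf C c]
    have "h (eval A (\<lambda>i. xs ! i) ?t) = eval B (h \<circ> (\<lambda>i. xs ! i)) ?t"
      using t(2) xs by (intro eval_hom[OF t(1) alg h]) (fastforce simp: in_tuples_iff)
    also have "\<dots> = eval B (\<lambda>i. map h xs ! i) ?t"
      using t(2) xs by (intro eval_cong_vars) (auto simp: in_tuples_iff)
    finally show ?thesis
      by (simp add: reduct_def)
  qed
  with h show ?thesis
    by (auto simp: is_hom_def clone_signature_Some)
qed

lemma reduct_Con:
  assumes "\<theta> \<in> Con \<Omega> A"
  shows "\<theta> \<in> Con (clone_signature C) (reduct \<Omega> Ax A)"
proof -
  have "(oper (reduct \<Omega> Ax A) c xs, oper (reduct \<Omega> Ax A) c ys) \<in> \<theta>"
    if c: "c \<in> C" and xs: "xs \<in> tuples (carrier A) (fst c)"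
      and rel: "list_all2 (\<lambda>x y. (x, y) \<in> \<theta>) xs ys" for c xs ys
  proof -
    note t = representing_term[OF wf C c]
    show ?thesis
      using t(2) xs rel
      by (auto simp: reduct_def in_tuples_iff list_all2_conv_all_nth intro!: eval_Con[OF t(1) assms])
  qed
  with Con_equiv[OF assms] show ?thesis
    by (auto simp: Con_def clone_signature_Some)
qed

end


section \<open>Structural completeness\<close>

theorem theorem4p5:
  fixes \<Omega> :: "'f signature"
    and Ax :: "'f quasieq set"
    and C :: "('f, nat) trm set operation set"
  assumes "\<forall>\<Phi>\<in>Ax. wf_quasieq \<Omega> \<Phi>"
    and "is_clone_of_term_operations \<Omega> Ax C"
    and "\<forall>\<theta>. compact_in (QCon \<Omega> Ax (free_alg \<Omega> Ax)) \<theta> \<longrightarrow>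
           u_presentable TYPE('i) \<Omega> Ax C (free_alg \<Omega> Ax) \<theta>"
  shows "structurally_complete TYPE('a) \<Omega> Ax C"
  unfolding structurally_complete_def
proof (intro allI impI ballI)
  fix \<Phi> and A :: "('f, 'a) alg"
  assume wf: "wf_quasieq (clone_signature C) \<Phi>"
    and satF: "satisfies (reduct \<Omega> Ax (free_alg \<Omega> Ax)) \<Phi>"
    and A: "A \<in> quasivariety \<Omega> Ax"
  let ?F = "free_alg \<Omega> Ax" and ?x = "generator \<Omega> Ax"
  let ?FC = "reduct \<Omega> Ax ?F" and ?AC = "reduct \<Omega> Ax A" and ?\<Sigma> = "clone_signature C"
  note W = wf_quasieqD[OF wf]
  note algF = free_alg_is_algebra[OF assms(1)]
  note algFC = reduct_is_algebra[OF assms(1,2) algF]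
  have x: "range ?x \<subseteq> carrier ?FC" "\<And>t :: (_, nat) trm. ?x ` vars t \<subseteq> carrier ?FC"
    by (auto simp: generator_in_carrier)
  have closed: "eval ?FC ?x t \<in> carrier ?F" if "wf_trm ?\<Sigma> t" for t
    using eval_closed[OF that algFC x(2)] by simp
  define X where "X = (\<lambda>(s, t). (eval ?FC ?x s, eval ?FC ?x t)) ` set (fst \<Phi>)"
  define \<theta> where "\<theta> = \<Inter>{\<phi> \<in> QCon \<Omega> Ax ?F. X \<subseteq> \<phi>}"
  have "X \<subseteq> carrier ?F \<times> carrier ?F"
    using closed W(1,2) by (auto simp: X_def)
  then have compact: "compact_in (QCon \<Omega> Ax ?F) \<theta>"
    unfolding \<theta>_def by (intro compact_QCon_generated[OF algF assms(1)]) (auto simp: X_def)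
  then obtain \<Delta> where \<Delta>: "\<Delta> \<subseteq> Con \<Omega> ?F" "\<theta> = \<Union>\<Delta>"
      "\<And>D. D \<subseteq> \<Delta> \<Longrightarrow> finite D \<Longrightarrow> D \<noteq> {} \<Longrightarrow> join_in (Con \<Omega> ?F) D \<in> \<Delta>"
      "\<And>\<delta>. \<delta> \<in> \<Delta> \<Longrightarrow> quotient_alg ?FC \<delta> \<in> ISPu TYPE('i) ?\<Sigma> {?FC}"
    using assms(3) unfolding u_presentable_def by metis
  \<comment> \<open>\<open>X\<close> may be empty, so \<open>\<Delta> \<noteq> {}\<close> has to come from reflexivity of \<open>\<theta>\<close>.\<close>
  have "(?x 0, ?x 0) \<in> \<theta>"
    using compact generator_in_carrier[of \<Omega> Ax 0]
    by (auto simp: compact_in_def QCon_def Con_def equiv_def refl_on_def)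
  then have ne: "\<Delta> \<noteq> {}"
    using \<Delta>(2) by auto
  have "\<exists>\<gamma>\<in>\<Delta>. \<alpha> \<union> \<beta> \<subseteq> \<gamma>" if "\<alpha> \<in> \<Delta>" "\<beta> \<in> \<Delta>" for \<alpha> \<beta>
    using \<Delta>(3)[of "{\<alpha>, \<beta>}"] that by (intro bexI[of _ "join_in (Con \<Omega> ?F) {\<alpha>, \<beta>}"]) (auto simp: join_in_def)
  moreover have "X \<subseteq> \<Union>\<Delta>" "finite X"
    using \<Delta>(2) by (auto simp: \<theta>_def X_def)
  ultimately obtain \<delta> where \<delta>: "\<delta> \<in> \<Delta>" "X \<subseteq> \<delta>"
    using finite_subset_of_directed_Union[of X \<Delta>] ne by blast
  have "satisfies (quotient_alg ?FC \<delta>) \<Phi>"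
    using satisfies_ISPu[OF \<Delta>(4)[OF \<delta>(1)] _ wf] satF algFC by blast
  then have "quasieq_closed ?FC \<Phi> \<delta>"
    using satisfies_quotient_iff[OF algFC _ wf] reduct_Con[OF assms(1,2)] \<Delta>(1) \<delta>(1) by blast
  moreover have "\<forall>(s, t) \<in> set (fst \<Phi>). (eval ?FC ?x s, eval ?FC ?x t) \<in> \<delta>"
    using \<delta>(2) unfolding X_def image_subset_iff by (simp only: case_prod_unfold)
  ultimately have "(eval ?FC ?x (fst (snd \<Phi>)), eval ?FC ?x (snd (snd \<Phi>))) \<in> \<delta>"
    using x(1) unfolding quasieq_closed_def by blast
  then have conclusion: "(eval ?FC ?x (fst (snd \<Phi>)), eval ?FC ?x (snd (snd \<Phi>))) \<in> \<theta>"
    using \<delta>(1) \<Delta>(2) by blast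
  show "satisfies ?AC \<Phi>"
    unfolding satisfies_def
  proof (intro allI impI)
    fix v :: "nat \<Rightarrow> 'a"
    assume v: "range v \<subseteq> carrier ?AC"
      and prem: "\<forall>(s, t) \<in> set (fst \<Phi>). eval ?AC v s = eval ?AC v t"
    obtain h where h: "is_hom \<Omega> h ?F A" "h \<circ> ?x = v"
      using free_alg_extend[OF assms(1) A] v by auto
    let ?K = "{(a, b). a \<in> carrier ?F \<and> b \<in> carrier ?F \<and> h a = h b}"
    have h_eval: "h (eval ?FC ?x t) = eval ?AC v t" if "wf_trm ?\<Sigma> t" for t
      using eval_hom[OF that algFC reduct_hom[OF assms(1,2) algF h(1)] x(2)] h(2) by simp
    have "(eval ?FC ?x s, eval ?FC ?x t) \<in> ?K" if "(s, t) \<in> set (fst \<Phi>)" for s t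
    proof -
      have "eval ?AC v s = eval ?AC v t"
        using prem that by auto
      then show ?thesis
        by (simp add: closed h_eval W(1,2)[OF that])
    qed
    then have "X \<subseteq> ?K"
      unfolding X_def by (intro image_subsetI) (simp only: split_paired_all case_prod_conv)
    then have "\<theta> \<subseteq> ?K"
      using hom_kernel_QCon[OF h(1) algF A assms(1)] by (auto simp: \<theta>_def)
    then have "h (eval ?FC ?x (fst (snd \<Phi>))) = h (eval ?FC ?x (snd (snd \<Phi>)))"
      using conclusion by blast
    then show "eval ?AC v (fst (snd \<Phi>)) = eval ?AC v (snd (snd \<Phi>))"
      using h_eval W(3,4) by simp
  qed
qed

end
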